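(* Let $n \geq 2$, $m \geq n$ and $t \geq 1$ be integers, and let $c_0, c_1, \ldots, c_{n-1}$ be integers with $c_0 = 1$, $c_{n-1} \geq c_{n-2} \geq \cdots \geq c_1 \geq 0$ and $c_{n-1} \geq c_0$. Let $u_{i,k}$ ($0 \le i \le n-1$, $k \ge 0$) be the sequences defined in the context from $(c_0,\ldots,c_{n-1})$. Let \[ f(X) = X^{n} - \left(u_{n-1,m}t + c_{n-1}\right)X^{n-1} - \left(u_{n-2,m}t + c_{n-2}\right)X^{n-2} - \cdots - \left(u_{0,m}t + c_{0}\right), \] and let $\omega$ be the unique positive real root of $f(X)$. Define $\boldsymbol{\alpha}^{(0)} = (\alpha_1^{(0)}, \ldots, \alpha_{n-1}^{(0)})$ by \[ \alpha_i^{(0)} = \sum_{j=0}^{i} \left(u_{j,m}t + c_j\right)\omega^{j-i}, \qquad i = 1, \ldots, n-1. \] Then the Jacobi–Perron Algorithm (JPA) expansion of $\boldsymbol{\alpha}^{(0)}$ is well defined (i.e. $\alpha_1^{(\nu)} \neq a_1^{(\nu)}$ for all $\nu \ge 0$) and is purely periodic with period length $m$. Moreover, for every $\nu \geq 0$, writing $r = \nu \bmod m \in \{0,1,\ldots,m-1\}$, the integer vectors $\mathbf{a}^{(\nu)} = (a_1^{(\nu)}, \ldots, a_{n-1}^{(\nu)})$ are: \begin{itemize} \item if $r = 0$: $\mathbf{a}^{(\nu)} = \left(u_{1,m}t + c_1, \ldots, u_{n-1,m}t + c_{n-1}\right)$; \item if $1 \leq r \leq m-n+1$: $\mathbf{a}^{(\nu)}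 = (c_1, \ldots, c_{n-1})$; \item if $m-n+2 \leq r \leq m-1$: $a_i^{(\nu)} = c_i$ for $1 \leq i \leq m-r$ and $a_i^{(\nu)} = u_{i,m}t + c_i$ for $m-r+1 \leq i \leq n-1$. \end{itemize} Furthermore, the Hasse–Bernstein unit of this expansion, $\epsilon = \prod_{\nu=0}^{m-1} \alpha_{n-1}^{(\nu)}$, equals \[ \epsilon = u_{n-1,m}\omega^{n-1} + u_{n-2,m}\omega^{n-2} + \cdots + u_{1,m}\omega + u_{0,m}. \]
   Context: Recurrence sequences: given $n \ge 2$ and non-negative integers $c_0, \ldots, c_{n-1}$ with $c_0, c_{n-1} \geq 1$, define for $i = 0, \ldots, n-1$ the sequence $(u_{i,k})_{k \geq 0}$ by $u_{i,k} = \delta_{i,k}$ (Kronecker delta) for $0 \leq k \leq n-1$, and $u_{i,k} = c_{n-1}u_{i,k-1} + c_{n-2}u_{i,k-2} + \cdots + c_0 u_{i,k-n}$ for $k \geq n$. Jacobi–Perron Algorithm (inhomogeneous form): for $\boldsymbol{\alpha}^{(0)} = (\alpha_1^{(0)}, \ldots, \alpha_{n-1}^{(0)}) \in \mathbb{R}^{n-1}$, define recursively $a_i^{(\nu)} = \lfloor \alpha_i^{(\nu)} \rfloor$ for $i=1,\ldots,n-1$ and, provided $\alpha_1^{(\nu)} \neq a_1^{(\nu)}$, \[ \boldsymbol{\alpha}^{(\nu+1)} = \left( \frac{\alpha_2^{(\nu)} - a_2^{(\nu)}}{\alpha_1^{(\nu)} - a_1^{(\nu)}}, \ldots, \frac{\alpha_{n-1}^{(\nu)}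 - a_{n-1}^{(\nu)}}{\alpha_1^{(\nu)} - a_1^{(\nu)}}, \frac{1}{\alpha_1^{(\nu)} - a_1^{(\nu)}} \right). \] The expansion is periodic if there exist integers $\ell_0 \geq 0$, $\ell_1 \geq 1$ with $\boldsymbol{\alpha}^{(\nu + \ell_1)} = \boldsymbol{\alpha}^{(\nu)}$ for all $\nu \geq \ell_0$; for the smallest such $\ell_0,\ell_1$, $\ell_1$ is the period length, and the expansion is purely periodic if $\ell_0 = 0$. For a periodic expansion with algebraic integer entries, the Hasse–Bernstein unit is $\prod_{i=\ell_0}^{\ell_0+\ell_1-1} \alpha_{n-1}^{(i)}$. *)

theory Defs
  imports Complex_Main "HOL-Computational_Algebra.Polynomial"
begin

function recurrence_seq :: "nat \<Rightarrow> (nat \<Rightarrow> int) \<Rightarrow> nat \<Rightarrow> nat \<Rightarrow> int" where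
  "recurrence_seq n c i k =
     (if k < n then (if i = k then 1 else 0)
      else (\<Sum>j<n. c j * recurrence_seq n c i (k - n + j)))"
  by pat_completeness auto
termination
  by (relation "measure (\<lambda>(n, c, i, k). k)") auto

declare recurrence_seq.simps [simp del]

text \<open>
  A vector of dimension \<open>n - 1\<close> is a function on indices of which only the
  entries \<open>1, \<dots>, n - 1\<close> matter. A step with integral first entry is a division
  by zero; \<open>jpa_well_defined\<close> states that this never happens.
\<close>

definition jpa_step :: "nat \<Rightarrow> (nat \<Rightarrow> real) \<Rightarrow> nat \<Rightarrow> real" where
  "jpa_step n \<alpha> i =
     (if i < n - 1
      then (\<alpha> (i + 1) - of_int \<lfloor>\<alpha> (i + 1)\<rfloor>) / (\<alpha> 1 - of_int \<lfloor>\<alpha> 1\<rfloor>)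
      else 1 / (\<alpha> 1 - of_int \<lfloor>\<alpha> 1\<rfloor>))"

definition jpa :: "nat \<Rightarrow> (nat \<Rightarrow> real) \<Rightarrow> nat \<Rightarrow> nat \<Rightarrow> real" where
  "jpa n \<alpha> \<nu> = (jpa_step n ^^ \<nu>) \<alpha>"

definition jpa_digit :: "nat \<Rightarrow> (nat \<Rightarrow> real) \<Rightarrow> nat \<Rightarrow> nat \<Rightarrow> int" where
  "jpa_digit n \<alpha> \<nu> i = \<lfloor>jpa n \<alpha> \<nu> i\<rfloor>"

definition jpa_well_defined :: "nat \<Rightarrow> (nat \<Rightarrow> real) \<Rightarrow> bool" where
  "jpa_well_defined n \<alpha> \<longleftrightarrow> (\<forall>\<nu>. jpa n \<alpha> \<nu> 1 \<noteq> of_int (jpa_digit n \<alpha> \<nu> 1))"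

definition jpa_has_period :: "nat \<Rightarrow> (nat \<Rightarrow> real) \<Rightarrow> nat \<Rightarrow> nat \<Rightarrow> bool" where
  "jpa_has_period n \<alpha> l\<^sub>0 l\<^sub>1 \<longleftrightarrow>
     l\<^sub>1 \<ge> 1 \<and> (\<forall>\<nu>\<ge>l\<^sub>0. \<forall>i\<in>{1..n-1}. jpa n \<alpha> (\<nu> + l\<^sub>1) i = jpa n \<alpha> \<nu> i)"

definition jpa_periodic :: "nat \<Rightarrow> (nat \<Rightarrow> real) \<Rightarrow> bool" where
  "jpa_periodic n \<alpha> \<longleftrightarrow> (\<exists>l\<^sub>0 l\<^sub>1. jpa_has_period n \<alpha> l\<^sub>0 l\<^sub>1)"

definition jpa_preperiod_length :: "nat \<Rightarrow> (nat \<Rightarrow> real) \<Rightarrow> nat" where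
  "jpa_preperiod_length n \<alpha> = (LEAST l\<^sub>0. \<exists>l\<^sub>1. jpa_has_period n \<alpha> l\<^sub>0 l\<^sub>1)"

definition jpa_period_length :: "nat \<Rightarrow> (nat \<Rightarrow> real) \<Rightarrow> nat" where
  "jpa_period_length n \<alpha> =
     (LEAST l\<^sub>1. jpa_has_period n \<alpha> (jpa_preperiod_length n \<alpha>) l\<^sub>1)"

definition jpa_purely_periodic :: "nat \<Rightarrow> (nat \<Rightarrow> real) \<Rightarrow> bool" where
  "jpa_purely_periodic n \<alpha> \<longleftrightarrow> jpa_periodic n \<alpha> \<and> jpa_preperiod_length n \<alpha> = 0"

definition hasse_bernstein_unit :: "nat \<Rightarrow> (nat \<Rightarrow> real) \<Rightarrow> real" where
  "hasse_bernstein_unit n \<alpha> =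
     (\<Prod>\<nu> = jpa_preperiod_length n \<alpha> ..< jpa_preperiod_length n \<alpha> + jpa_period_length n \<alpha>.
        jpa n \<alpha> \<nu> (n - 1))"

end

theory Submission
  imports Defs
begin

text \<open>
  Put \<open>d\<^sub>i = u\<^sub>i\<^sub>,\<^sub>m t + c\<^sub>i\<close> and \<open>q\<^sub>p = u\<^bsub>n-1,m-1-p\<^esub>\<close>. Modulo \<open>\<chi>(X) = X\<^sup>n - \<Sum> c\<^sub>i X\<^sup>i\<close> we have
  \<open>X\<^sup>m \<equiv> \<epsilon>(X) = \<Sum> u\<^sub>i\<^sub>,\<^sub>m X\<^sup>i\<close> with quotient \<open>\<Sum> q\<^sub>p X\<^sup>p\<close>, and \<open>f = \<chi> - t \<epsilon>\<close>.
  The expansion is governed by the numbers \<open>y\<^sub>s = \<omega>\<^bsup>-s\<^esup> (1 + t \<Sum>\<^bsub>p<s\<^esub> q\<^sub>p \<omega>\<^sup>p)\<close>. They satisfy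
  \<open>y\<^sub>r = \<Sum>\<^bsub>j<n\<^esub> c\<^sub>j y\<^bsub>r+n-j\<^esub>\<close> for \<open>r \<le> m - n\<close> and form a geometric progression of ratio
  \<open>1/\<omega>\<close> from index \<open>m - n + 1\<close> to \<open>m\<close>. The \<open>i\<close>-th entry of the \<open>r\<close>-th complete quotient is
  \<open>c\<^sub>i + \<Sum>\<^bsub>j<i\<^esub> c\<^sub>j y\<^bsub>r+i-j\<^esub> / y\<^sub>r\<close> when \<open>0 < r \<le> m - i\<close> and agrees with that of \<open>\<alpha>\<^sup>(\<^sup>0\<^sup>)\<close> otherwise.
  The monotonicity of the \<open>c\<^sub>i\<close> makes the sum divided by \<open>y\<^sub>r\<close> less than 1, which
  identifies the digits. The product of the last entries telescopes to \<open>1 / y\<^sub>m\<close>, and evaluating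
  the division of \<open>X\<^sup>m\<close> by \<open>\<chi>\<close> at \<open>\<omega>\<close> gives \<open>\<epsilon>(\<omega>) y\<^sub>m = 1\<close>.
\<close>

section \<open>The recurrence sequences\<close>

lemma recurrence_seq_initial:
  "k < n \<Longrightarrow> recurrence_seq n c i k = (if i = k then 1 else 0)"
  by (subst recurrence_seq.simps) simp

lemma recurrence_seq_rec:
  "n \<le> k \<Longrightarrow> recurrence_seq n c i k = (\<Sum>j<n. c j * recurrence_seq n c i (k - n + j))"
  by (subst recurrence_seq.simps) simp

lemma recurrence_seq_at_order:
  assumes "i < n"
  shows "recurrence_seq n c i n = c i"
proof -
  have "recurrence_seq n c i n = (\<Sum>j<n. if j = i then c j else 0)"
    unfolding recurrence_seq_rec[OF order_refl]
    by (intro sum.cong) (auto simp: recurrence_seq_initial)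
  with assms show ?thesis by simp
qed

lemma recurrence_seq_nonneg:
  assumes "\<And>j. j < n \<Longrightarrow> 0 \<le> c j"
  shows "0 \<le> recurrence_seq n c i k"
proof (induction k rule: less_induct)
  case (less k)
  show ?case
  proof (cases "k < n")
    case False
    then show ?thesis
      using assms less
      by (subst recurrence_seq_rec) (auto intro!: sum_nonneg mult_nonneg_nonneg)
  qed (simp add: recurrence_seq_initial)
qed

text \<open>The \<open>u i k\<close> are the coefficients of X^k reduced modulo X^n - sum c_i X^i.
  This and the next lemma describe multiplication by X, which turns the leading coefficient into a
  multiple of the \<open>c i\<close>. Both sides obey the same recurrence in \<open>k\<close>, so
  agreement for \<open>k < n\<close> suffices.\<close>

lemma recurrence_seq_0_Suc:
  assumes "0 < n"
  shows "recurrence_seq n c 0 (Suc k) = c 0 * recurrence_seq n c (n - 1) k"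
proof (induction k rule: less_induct)
  case (less k)
  consider "Suc k < n" | "Suc k = n" | "n \<le> k" by linarith
  then show ?case
  proof cases
    case 1
    then show ?thesis by (simp add: recurrence_seq_initial)
  next
    case 2
    with assms have "k = n - 1" by simp
    then show ?thesis
      using 2 assms by (simp add: recurrence_seq_initial recurrence_seq_at_order)
  next
    case 3
    have "recurrence_seq n c 0 (Suc k)
        = (\<Sum>j<n. c j * recurrence_seq n c 0 (Suc (k - n + j)))"
      using 3 by (subst recurrence_seq_rec) (auto simp: Suc_diff_le)
    also have "\<dots> = (\<Sum>j<n. c j * (c 0 * recurrence_seq n c (n - 1) (k - n + j)))"
      using 3 by (intro sum.cong refl arg_cong2[of _ _ _ _ "(*)"] less) auto
    also have "\<dots> = c 0 * recurrence_seq n c (n - 1) k"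
      unfolding recurrence_seq_rec[OF 3, of c "n - 1"]
      by (simp add: sum_distrib_left algebra_simps)
    finally show ?thesis .
  qed
qed

lemma recurrence_seq_Suc_Suc:
  assumes "Suc i < n"
  shows "recurrence_seq n c (Suc i) (Suc k)
    = recurrence_seq n c i k + c (Suc i) * recurrence_seq n c (n - 1) k"
proof (induction k rule: less_induct)
  case (less k)
  consider "Suc k < n" | "Suc k = n" | "n \<le> k" by linarith
  then show ?case
  proof cases
    case 1
    then show ?thesis by (simp add: recurrence_seq_initial)
  next
    case 2
    then have "k = n - 1" by simp
    then show ?thesis
      using 2 assms by (simp add: recurrence_seq_initial recurrence_seq_at_order)
  next
    case 3
    have "recurrence_seq n c (Suc i) (Suc k)
        = (\<Sum>j<n. c j * recurrence_seq n c (Suc i) (Suc (k - n + j)))"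
      using 3 by (subst recurrence_seq_rec) (auto simp: Suc_diff_le)
    also have "\<dots> = (\<Sum>j<n. c j * (recurrence_seq n c i (k - n + j)
        + c (Suc i) * recurrence_seq n c (n - 1) (k - n + j)))"
      using 3 by (intro sum.cong refl arg_cong2[of _ _ _ _ "(*)"] less) auto
    also have "\<dots> = recurrence_seq n c i k + c (Suc i) * recurrence_seq n c (n - 1) k"
      unfolding recurrence_seq_rec[OF 3, of c i] recurrence_seq_rec[OF 3, of c "n - 1"]
      by (simp add: sum_distrib_left sum.distrib algebra_simps)
    finally show ?thesis .
  qed
qed

text \<open>Unrolls the shift rule along the diagonal down to index 0; \<open>i < k\<close> keeps
  the natural subtractions exact. All sequences are thereby expressed through the last one.\<close>

lemma recurrence_seq_convolution:
  assumes "i < n" "i < k"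
  shows "recurrence_seq n c i k = (\<Sum>j\<le>i. c j * recurrence_seq n c (n - 1) (k - 1 - (i - j)))"
  using assms
proof (induction i arbitrary: k)
  case 0
  then show ?case using recurrence_seq_0_Suc[of n c "k - 1"] by simp
next
  case (Suc i)
  then obtain k' where k: "k = Suc k'" by (cases k) auto
  have "(\<Sum>j\<le>i. c j * recurrence_seq n c (n - 1) (k' - 1 - (i - j)))
      = (\<Sum>j\<le>i. c j * recurrence_seq n c (n - 1) (k - 1 - (Suc i - j)))"
    using k by (intro sum.cong) (auto simp: Suc_diff_le)
  then show ?case
    using Suc.IH[of k'] Suc.prems k by (simp add: recurrence_seq_Suc_Suc)
qed

text \<open>Multiplication by \<open>x\<close> modulo \<open>X\<^sup>n - \<Sum> c\<^sub>i X\<^sup>i\<close>, evaluated at \<open>x\<close>.\<close>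

lemma recurrence_seq_poly_Suc:
  fixes x :: real
  assumes "0 < n"
  shows "(\<Sum>i<n. of_int (recurrence_seq n c i (Suc k)) * x ^ i)
    = x * (\<Sum>i<n. of_int (recurrence_seq n c i k) * x ^ i)
      - of_int (recurrence_seq n c (n - 1) k) * (x ^ n - (\<Sum>i<n. of_int (c i) * x ^ i))"
proof -
  obtain N where n: "n = Suc N" using assms by (cases n) auto
  let ?u = "recurrence_seq n c"
  have "(\<Sum>i<n. of_int (?u i (Suc k)) * x ^ i)
      = of_int (?u 0 (Suc k)) + (\<Sum>i<N. of_int (?u (Suc i) (Suc k)) * x ^ Suc i)"
    by (simp only: n sum.lessThan_Suc_shift) simp
  also have "(\<Sum>i<N. of_int (?u (Suc i) (Suc k)) * x ^ Suc i)
      = (\<Sum>i<N. of_int (?u i k + c (Suc i) * ?u N k) * x ^ Suc i)"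
    using recurrence_seq_Suc_Suc[of _ n c k] n by (intro sum.cong) auto
  also have "\<dots> = x * (\<Sum>i<N. of_int (?u i k) * x ^ i)
      + of_int (?u N k) * (\<Sum>i<N. of_int (c (Suc i)) * x ^ Suc i)"
    by (simp add: sum.distrib sum_distrib_left algebra_simps)
  also have "(\<Sum>i<N. of_int (?u i k) * x ^ i)
      = (\<Sum>i<n. of_int (?u i k) * x ^ i) - of_int (?u N k) * x ^ N"
    by (simp add: n)
  also have "(\<Sum>i<N. of_int (c (Suc i)) * x ^ Suc i) = (\<Sum>i<n. of_int (c i) * x ^ i) - of_int (c 0)"
    by (simp only: n sum.lessThan_Suc_shift) simp
  also have "?u 0 (Suc k) = c 0 * ?u N k"
    using recurrence_seq_0_Suc[OF assms, of c k] n by simp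
  finally show ?thesis
    by (simp add: n algebra_simps)
qed

section \<open>Comparison of weighted sums\<close>

text \<open>The only place where the monotonicity of the coefficients enters. Aligned at \<open>z 1\<close>, the
  longer sum dominates termwise except possibly for the coefficient \<open>c 0 = 1\<close> of \<open>z i\<close>; a deficit
  there is compensated at the first positive coefficient after \<open>c 0\<close>.\<close>

lemma weighted_sum_less:
  fixes c :: "nat \<Rightarrow> int" and z :: "nat \<Rightarrow> real"
  assumes c0: "c 0 = 1"
    and c_nonneg: "\<And>j. j < n \<Longrightarrow> 0 \<le> c j"
    and c_mono: "\<And>i j. 1 \<le> i \<Longrightarrow> i \<le> j \<Longrightarrow> j < n \<Longrightarrow> c i \<le> c j"
    and c_last: "1 \<le> c (n - 1)"
    and z_pos: "\<And>s. 1 \<le> s \<Longrightarrow> s \<le> n \<Longrightarrow> 0 < z s"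
    and z_antimono: "\<And>s s'. 1 \<le> s \<Longrightarrow> s \<le> s' \<Longrightarrow> s' \<le> n \<Longrightarrow> z s' \<le> z s"
    and i: "1 \<le> i" "i < n"
  shows "(\<Sum>j<i. of_int (c j) * z (i - j)) < (\<Sum>j<n. of_int (c j) * z (n - j))"
proof -
  have reindex: "(\<Sum>j<l. of_int (c j) * z (l - j)) = (\<Sum>s=1..l. of_int (c (l - s)) * z s)" for l
    by (rule sum.reindex_bij_witness[of _ "\<lambda>s. l - s" "\<lambda>j. l - j"]) auto
  define w where "w s = c (n - s) - c (i - s)" for s
  have w_nonneg: "0 \<le> of_int (w s) * z s" if "s \<in> {1..<i}" for s
    using that i c_mono[of "i - s" "n - s"] z_pos[of s] by (auto simp: w_def)
  have split_last: "(\<Sum>s=1..i. of_int (w s) * z s)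
      = (\<Sum>s=1..<i. of_int (w s) * z s) + of_int (w i) * z i"
    using i by (simp add: sum.last_plus)
  have "0 \<le> (\<Sum>s=1..i. of_int (w s) * z s)"
  proof (cases "1 \<le> c (n - i)")
    case True
    then have "0 \<le> of_int (w i) * z i"
      using i z_pos[of i] c0 by (simp add: w_def)
    with w_nonneg show ?thesis
      unfolding split_last by (intro add_nonneg_nonneg sum_nonneg) auto
  next
    case False
    with c_nonneg[of "n - i"] i have cni: "c (n - i) = 0" by auto
    define k where "k = (LEAST k. 1 \<le> k \<and> 1 \<le> c k)"
    have n1: "1 \<le> n - 1 \<and> 1 \<le> c (n - 1)" using i c_last by auto
    have k: "1 \<le> k" "1 \<le> c k" "k \<le> n - 1"
      using LeastI[of "\<lambda>k. 1 \<le> k \<and> 1 \<le> c k", OF n1]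
        Least_le[of "\<lambda>k. 1 \<le> k \<and> 1 \<le> c k", OF n1] by (auto simp: k_def)
    have k_gt: "n - i < k"
      using c_mono[of k "n - i"] k cni i by (cases "k \<le> n - i") auto
    \<comment> \<open>Here the longer sum has coefficient \<open>c k \<ge> 1\<close>, while the
      shorter one has \<open>c (i - s)\<close> with \<open>0 < i - s < k\<close>, which vanishes by
      minimality of \<open>k\<close>. As \<open>s < i\<close>, the surplus at \<open>z s\<close>
      pays for \<open>z i\<close>.\<close>
    define s where "s = n - k"
    have s: "s \<in> {1..<i}" "n - s = k" "1 \<le> i - s" "i - s < k" "i - s < n"
      using k k_gt i by (auto simp: s_def)
    have "c (i - s) \<le> 0"
      using not_less_Least[of "i - s" "\<lambda>k. 1 \<le> k \<and> 1 \<le> c k", folded k_def] s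
      by linarith
    then have "1 \<le> w s" using k s by (simp add: w_def)
    have "z i \<le> z s" using s i by (intro z_antimono) auto
    also have "\<dots> \<le> of_int (w s) * z s"
      using \<open>1 \<le> w s\<close> z_pos[of s] s i by (simp add: mult_le_cancel_right1)
    also have "\<dots> \<le> (\<Sum>s=1..<i. of_int (w s) * z s)"
      using s w_nonneg by (intro member_le_sum) auto
    finally show ?thesis
      unfolding split_last using cni c0 by (simp add: w_def)
  qed
  also have "\<dots> = (\<Sum>s=1..i. of_int (c (n - s)) * z s) - (\<Sum>j<i. of_int (c j) * z (i - j))"
    unfolding reindex w_def by (simp add: sum_subtractf algebra_simps)
  also have "\<dots> < (\<Sum>j<n. of_int (c j) * z (n - j)) - (\<Sum>j<i. of_int (c j) * z (i - j))"
  proof -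
    have "{1..n} = {1..i} \<union> {i+1..n}" using i by auto
    then have "(\<Sum>s=1..n. of_int (c (n - s)) * z s)
        = (\<Sum>s=1..i. of_int (c (n - s)) * z s) + (\<Sum>s=i+1..n. of_int (c (n - s)) * z s)"
      by (simp add: sum.union_disjoint)
    moreover have "0 < (\<Sum>s=i+1..n. of_int (c (n - s)) * z s)"
      by (rule sum_pos2[of _ n])
        (use i c0 z_pos c_nonneg in \<open>auto intro!: mult_nonneg_nonneg simp: less_imp_le\<close>)
    ultimately show ?thesis unfolding reindex by simp
  qed
  finally show ?thesis by simp
qed

section \<open>Positive roots\<close>

text \<open>Existence is the intermediate value theorem. For uniqueness, division by
  \<open>x ^ n\<close> gives the equation sum d_i / x^(n-i) = 1, whose left side is strictly
  decreasing in x > 0 because \<open>d 0 > 0\<close>.\<close>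

lemma unique_positive_root:
  fixes d :: "nat \<Rightarrow> real"
  assumes n: "0 < n" and d0: "0 < d 0" and d_nonneg: "\<And>i. i < n \<Longrightarrow> 0 \<le> d i"
  shows "\<exists>!x. 0 < x \<and> poly (monom 1 n - (\<Sum>i<n. monom (d i) i)) x = 0"
proof -
  define f where "f = monom 1 n - (\<Sum>i<n. monom (d i) i)"
  have f: "poly f x = x ^ n - (\<Sum>i<n. d i * x ^ i)" for x
    by (simp add: f_def poly_sum poly_monom)
  \<comment> \<open>A point where f is positive: since \<open>B \<ge> 1\<close>, the lower terms sum
    to at most \<open>(B - 1) * B ^ (n - 1)\<close>.\<close>
  define B where "B = 1 + (\<Sum>i<n. d i)"
  have B: "1 \<le> B" using d_nonneg by (auto simp: B_def intro!: sum_nonneg)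
  have "(\<Sum>i<n. d i * B ^ i) \<le> (\<Sum>i<n. d i * B ^ (n - 1))"
    using B d_nonneg by (intro sum_mono mult_left_mono power_increasing) auto
  also have "\<dots> = (B - 1) * B ^ (n - 1)" by (simp add: B_def sum_distrib_right)
  also have "\<dots> < B * B ^ (n - 1)" using B by (intro mult_strict_right_mono) auto
  also have "\<dots> = B ^ n" using n by (cases n) auto
  finally have "0 < poly f B" by (simp add: f)
  moreover have "poly f 0 < 0"
  proof -
    have "(\<Sum>i<n. d i * 0 ^ i) = d 0"
      using n by (subst sum.mono_neutral_right[of _ "{0}"]) auto
    then show ?thesis using n d0 by (simp add: f power_0_left)
  qed
  ultimately obtain x where x: "0 < x" "poly f x = 0"
    using poly_IVT_pos[of 0 B f] B by auto
  have no_two: False if "0 < x" "x < y" "poly f x = 0" "poly f y = 0" for x y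
  proof -
    have eq1: "(\<Sum>i<n. d i / z ^ (n - i)) = 1" if z: "0 < z" "poly f z = 0" for z
    proof -
      have "(\<Sum>i<n. d i / z ^ (n - i)) = (\<Sum>i<n. d i * z ^ i / z ^ n)"
        using z by (intro sum.cong) (auto simp: power_diff)
      also have "\<dots> = z ^ n / z ^ n"
        using z f[of z] by (simp add: sum_divide_distrib[symmetric])
      also have "\<dots> = 1" using z by simp
      finally show ?thesis .
    qed
    have "(\<Sum>i<n. d i / y ^ (n - i)) < (\<Sum>i<n. d i / x ^ (n - i))"
    proof (rule sum_strict_mono_ex1)
      show "\<forall>i\<in>{..<n}. d i / y ^ (n - i) \<le> d i / x ^ (n - i)"
        using that d_nonneg by (auto intro!: divide_left_mono power_mono mult_pos_pos)
      have "d 0 / y ^ n < d 0 / x ^ n"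
        using that d0 n by (intro divide_strict_left_mono power_strict_mono mult_pos_pos) auto
      then show "\<exists>i\<in>{..<n}. d i / y ^ (n - i) < d i / x ^ (n - i)"
        using n by (intro bexI[of _ 0]) auto
    qed simp
    with eq1[of x] eq1[of y] that show False by auto
  qed
  have "y = x" if "0 < y" "poly f y = 0" for y
    using no_two[of x y] no_two[of y x] x that by (cases x y rule: linorder_cases) auto
  with x show ?thesis unfolding f_def[symmetric] by blast
qed

section \<open>Complete quotients of the expansion\<close>

lemma jpa_Suc: "jpa n \<alpha> (Suc \<nu>) = jpa_step n (jpa n \<alpha> \<nu>)"
  by (simp add: jpa_def)

lemma jpa_step_cong:
  assumes "2 \<le> n" "\<And>i. i \<in> {1..n-1} \<Longrightarrow> \<alpha> i = \<beta> i"
  shows "jpa_step n \<alpha> i = jpa_step n \<beta> i"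
  using assms by (auto simp: jpa_step_def)

locale perturbed_recurrence =
  fixes n m :: nat and t :: int and c :: "nat \<Rightarrow> int" and \<omega> :: real
  assumes n: "2 \<le> n" and m: "n \<le> m" and t: "1 \<le> t"
    and c0: "c 0 = 1"
    and c_nonneg: "\<And>j. j < n \<Longrightarrow> 0 \<le> c j"
    and c_mono: "\<And>i j. 1 \<le> i \<Longrightarrow> i \<le> j \<Longrightarrow> j < n \<Longrightarrow> c i \<le> c j"
    and c_last: "1 \<le> c (n - 1)"
    and \<omega>_pos: "0 < \<omega>"
    and \<omega>_root: "\<omega> ^ n = (\<Sum>i<n. of_int (recurrence_seq n c i m * t + c i) * \<omega> ^ i)"
begin

abbreviation u :: "nat \<Rightarrow> nat \<Rightarrow> int" where "u \<equiv> recurrence_seq n c"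

definition d :: "nat \<Rightarrow> int" where "d i = u i m * t + c i"

definition q :: "nat \<Rightarrow> int" where "q p = u (n - 1) (m - 1 - p)"

text \<open>The product of the first \<open>s\<close> fractional parts of the first coordinate, that is, the first
  entry of the \<open>s\<close>-th vector of the homogeneous algorithm started at \<open>(1, \<alpha>\<^sub>1, \<dots>, \<alpha>\<^bsub>n-1\<^esub>)\<close>.\<close>

definition y :: "nat \<Rightarrow> real" where
  "y s = (1 + of_int t * (\<Sum>p<s. of_int (q p) * \<omega> ^ p)) / \<omega> ^ s"

text \<open>The full sum \<open>S r n\<close> is the right side of the recurrence for
  \<open>y r\<close>; the shorter sums supply the fractional parts.\<close>

definition S :: "nat \<Rightarrow> nat \<Rightarrow> real" where
  "S r i = (\<Sum>j<i. of_int (c j) * y (r + i - j))"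

definition \<alpha>\<^sub>0 :: "nat \<Rightarrow> real" where
  "\<alpha>\<^sub>0 i = (\<Sum>j\<le>i. of_int (d j) * \<omega> ^ j) / \<omega> ^ i"

text \<open>The formula is meant for \<open>0 \<le> r \<le> m\<close>. Including
  \<open>r = m\<close>, where it gives the initial vector again, lets the step lemma close the
  cycle.\<close>

definition quot :: "nat \<Rightarrow> nat \<Rightarrow> real" where
  "quot r i = (if r = 0 \<or> m < r + i then \<alpha>\<^sub>0 i else of_int (c i) + S r i / y r)"

section \<open>Size of the coefficients and of the root\<close>

lemma u_nonneg: "0 \<le> u i k"
  using c_nonneg by (rule recurrence_seq_nonneg)

lemma c_le_d: "c i \<le> d i"
  using u_nonneg[of i m] t by (simp add: d_def)

lemma u_last_pos:
  assumes "n - 1 \<le> k"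
  shows "1 \<le> u (n - 1) k"
  using assms
proof (induction k rule: dec_induct)
  case base
  show ?case using n by (simp add: recurrence_seq_initial)
next
  case (step k)
  have "u (n - 1) (Suc k) = u (n - 2) k + c (n - 1) * u (n - 1) k"
    using recurrence_seq_Suc_Suc[of "n - 2" n c k] n by (simp add: numeral_2_eq_2 Suc_diff_Suc)
  moreover have "1 * 1 \<le> c (n - 1) * u (n - 1) k"
    using step c_last by (intro mult_mono) auto
  ultimately show ?case using u_nonneg[of "n - 2" k] by linarith
qed

text \<open>Strictness distinguishes the two possible last digits, on which minimality of the period
  rests.\<close>

lemma c_last_less_d_last: "c (n - 1) < d (n - 1)"
proof -
  have "1 * 1 \<le> u (n - 1) m * t"
    using u_last_pos[of m] u_nonneg t m by (intro mult_mono) auto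
  then show ?thesis by (simp add: d_def)
qed

lemma \<omega>_gt_1: "1 < \<omega>"
proof -
  have d_nonneg: "0 \<le> d j" if "j < n" for j using c_le_d[of j] c_nonneg[OF that] by simp
  have "1 * \<omega> ^ (n - 1) \<le> of_int (d (n - 1)) * \<omega> ^ (n - 1)"
    using c_le_d[of "n - 1"] c_last \<omega>_pos by (intro mult_right_mono) auto
  also have "\<dots> < of_int (d 0) + of_int (d (n - 1)) * \<omega> ^ (n - 1)"
    using c_le_d[of 0] c0 by simp
  also have "\<dots> = (\<Sum>j\<in>{0, n - 1}. of_int (d j) * \<omega> ^ j)"
    using n by simp
  also have "\<dots> \<le> (\<Sum>j<n. of_int (d j) * \<omega> ^ j)"
    using n \<omega>_pos d_nonneg by (intro sum_mono2) auto
  also have "\<dots> = \<omega> * \<omega> ^ (n - 1)"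
    using \<omega>_root n power_Suc[of \<omega> "n - 1"] by (simp add: d_def)
  finally show ?thesis using \<omega>_pos by (simp add: mult_less_cancel_right)
qed

section \<open>The numbers \<open>y\<close> and their partial recurrence sums\<close>

lemma q_vanish: "m - n < p \<Longrightarrow> p < m \<Longrightarrow> q p = 0"
  using m n by (auto simp: q_def recurrence_seq_initial)

lemma y_0: "y 0 = 1"
  by (simp add: y_def)

lemma y_pos: "0 < y s"
proof -
  have "0 \<le> (\<Sum>p<s. of_int (q p) * \<omega> ^ p)"
    using \<omega>_pos u_nonneg by (auto intro!: sum_nonneg simp: q_def)
  then show ?thesis using t \<omega>_pos by (auto simp: y_def intro!: divide_pos_pos add_pos_nonneg)
qed

lemma y_Suc: "y (Suc s) = (y s + of_int (t * q s)) / \<omega>"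
  using \<omega>_pos by (simp add: y_def field_simps)

lemma y_Suc_geometric: "m - n < s \<Longrightarrow> s < m \<Longrightarrow> y (Suc s) = y s / \<omega>"
  by (simp add: y_Suc q_vanish)

lemma S_peel: "S r (Suc i) = of_int (c i) * y (Suc r) + S (Suc r) i"
  by (simp add: S_def)

text \<open>Apply \<open>y_Suc\<close> to each term. Lengthening the sum, or shifting it as in
  \<open>S_Suc_left\<close>, divides by \<open>\<omega>\<close> after adding a convolution of
  \<open>c\<close> with \<open>q\<close>; this convolution is \<open>u i m\<close> in
  \<open>S_0\<close> and \<open>q r\<close> in \<open>S_full\<close>.\<close>

lemma S_Suc_right:
  "S r (Suc i) = (S r i + of_int (c i) * y r + of_int (t * (\<Sum>j\<le>i. c j * q (r + i - j)))) / \<omega>"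
proof -
  have "S r (Suc i) = (\<Sum>j\<le>i. of_int (c j) * y (Suc (r + i - j)))"
    by (auto simp: S_def lessThan_Suc_atMost Suc_diff_le intro!: sum.cong)
  also have "\<dots> = ((\<Sum>j\<le>i. of_int (c j) * y (r + i - j))
      + of_int (t * (\<Sum>j\<le>i. c j * q (r + i - j)))) / \<omega>"
    by (simp add: y_Suc sum_divide_distrib[symmetric] sum.distrib sum_distrib_left algebra_simps)
  also have "(\<Sum>j\<le>i. of_int (c j) * y (r + i - j)) = S r i + of_int (c i) * y r"
    by (simp add: S_def lessThan_Suc_atMost[symmetric])
  finally show ?thesis .
qed

lemma S_Suc_left:
  "S (Suc r) i = (S r i + of_int (t * (\<Sum>j<i. c j * q (r + i - j)))) / \<omega>"
proof -
  have "S (Suc r) i = (\<Sum>j<i. of_int (c j) * y (Suc (r + i - j)))"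
    by (auto simp: S_def Suc_diff_le intro!: sum.cong)
  also have "\<dots> = (S r i + of_int (t * (\<Sum>j<i. c j * q (r + i - j)))) / \<omega>"
    by (simp add: S_def y_Suc sum_divide_distrib[symmetric] sum.distrib sum_distrib_left algebra_simps)
  finally show ?thesis .
qed

lemma S_0: "i \<le> n \<Longrightarrow> S 0 i = (\<Sum>j<i. of_int (d j) * \<omega> ^ j) / \<omega> ^ i"
proof (induction i)
  case 0
  show ?case by (simp add: S_def)
next
  case (Suc i)
  have "(\<Sum>j\<le>i. c j * q (i - j)) = u i m"
    using recurrence_seq_convolution[of i n m c] Suc.prems m by (simp add: q_def)
  then have "S 0 (Suc i) = (S 0 i + of_int (d i)) / \<omega>"
    by (simp add: S_Suc_right y_0 d_def algebra_simps)
  then show ?case using Suc \<omega>_pos by (simp add: field_simps)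
qed

text \<open>The base case is the root equation of \<open>\<omega>\<close>. The induction step is the
  recurrence of the last sequence read backwards, available because
  \<open>m - 1 - r \<ge> n\<close>.\<close>

lemma S_full: "r \<le> m - n \<Longrightarrow> S r n = y r"
proof (induction r)
  case 0
  have "S 0 n = \<omega> ^ n / \<omega> ^ n" unfolding S_0[OF order_refl] d_def \<omega>_root[symmetric] ..
  then show ?case using \<omega>_pos by (simp add: y_0)
next
  case (Suc r)
  have "q r = (\<Sum>j<n. c j * q (r + n - j))"
    using Suc.prems m unfolding q_def
    by (subst recurrence_seq_rec) (auto intro!: sum.cong arg_cong[of _ _ "u (n - 1)"])
  then show ?case using Suc by (simp add: S_Suc_left y_Suc)
qed

lemma S_pos:
  assumes "1 \<le> i" "i \<le> n"
  shows "0 < S r i"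
  unfolding S_def
  by (rule sum_pos2[of _ 0])
    (use assms y_pos c0 c_nonneg in \<open>auto intro!: mult_nonneg_nonneg simp: less_imp_le\<close>)

section \<open>Monotonicity of \<open>y\<close> and the bound on the partial sums\<close>

lemma y_decreasing:
  assumes "s < m"
  shows "y (Suc s) < y s"
proof (cases "s \<le> m - n")
  case True
  have "y (Suc s) \<le> of_int (c (n - 1)) * y (Suc s)"
    using c_last y_pos[of "Suc s"] by (simp add: mult_le_cancel_right1)
  also have "\<dots> < y (s + n) + of_int (c (n - 1)) * y (Suc s)"
    using y_pos by simp
  \<comment> \<open>Only the two extreme terms of \<open>S s n\<close> are kept; they are distinct
    since \<open>n \<ge> 2\<close>.\<close>
  also have "\<dots> = (\<Sum>j\<in>{0, n - 1}. of_int (c j) * y (s + n - j))"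
    using n c0 by (simp add: Suc_diff_le)
  also have "\<dots> \<le> S s n"
    unfolding S_def using n y_pos c_nonneg by (intro sum_mono2) (auto simp: less_imp_le)
  also have "\<dots> = y s" using True by (rule S_full)
  finally show ?thesis .
next
  case False
  with assms have "y (Suc s) = y s / \<omega>" by (intro y_Suc_geometric) auto
  then show ?thesis using y_pos[of s] \<omega>_gt_1 by (simp add: divide_less_eq mult_less_cancel_left1)
qed

lemma y_antimono: "s \<le> s' \<Longrightarrow> s' \<le> m \<Longrightarrow> y s' \<le> y s"
proof (induction s' rule: dec_induct)
  case (step s')
  then show ?case using y_decreasing[of s'] by simp
qed simp

text \<open>Compares \<open>S r i\<close> with the full sum \<open>S r n = y r\<close> through
  \<open>weighted_sum_less\<close>; \<open>r \<le> m - n\<close> keeps all indices in the range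
  where \<open>y\<close> decreases.\<close>

lemma S_less_y_early:
  assumes "1 \<le> i" "i < n" "r \<le> m - n"
  shows "S r i < y r"
proof -
  have "(\<Sum>j<i. of_int (c j) * y (r + (i - j))) < (\<Sum>j<n. of_int (c j) * y (r + (n - j)))"
    using c0 c_nonneg c_mono c_last
  proof (rule weighted_sum_less)
    fix s s' assume "1 \<le> s" "s \<le> s'" "s' \<le> n"
    then show "y (r + s') \<le> y (r + s)"
      using assms m by (intro y_antimono) auto
  qed (use y_pos assms in auto)
  then have "S r i < S r n" by (simp add: S_def)
  then show ?thesis using assms by (simp add: S_full)
qed

lemma y_geometric:
  assumes "m - n < r" "r + k \<le> m"
  shows "y (r + k) = y r / \<omega> ^ k"
  using assms(2)
proof (induction k)
  case (Suc k)
  then show ?case using assms(1) y_Suc_geometric[of "r + k"] \<omega>_pos by simp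
qed simp

text \<open>In the late range \<open>y\<close> is geometric, so \<open>c \<le> d\<close> bounds
  \<open>S r i\<close> by \<open>y r * S 0 i\<close>, and \<open>S 0 i < 1\<close> is the early case
  at index 0.\<close>

lemma S_less_y:
  assumes "1 \<le> i" "i < n" "r + i \<le> m"
  shows "S r i < y r"
proof (cases "r \<le> m - n")
  case True
  then show ?thesis using assms S_less_y_early by blast
next
  case False
  have "S r i = (\<Sum>j<i. of_int (c j) * (y r / \<omega> ^ (i - j)))"
    unfolding S_def using False assms y_geometric
    by (intro sum.cong) (auto simp flip: Nat.add_diff_assoc)
  also have "\<dots> \<le> (\<Sum>j<i. of_int (d j) * (y r / \<omega> ^ (i - j)))"
    using c_le_d y_pos[of r] \<omega>_pos by (intro sum_mono mult_right_mono) auto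
  also have "\<dots> = y r * ((\<Sum>j<i. of_int (d j) * \<omega> ^ j) / \<omega> ^ i)"
    unfolding sum_distrib_left sum_divide_distrib using \<omega>_pos
    by (intro sum.cong) (auto simp: power_diff)
  also have "\<dots> = y r * S 0 i" using assms by (simp add: S_0)
  also have "\<dots> < y r * 1"
    using S_less_y_early[of i 0] assms y_pos[of r] by (intro mult_strict_left_mono) (auto simp: y_0)
  finally show ?thesis by simp
qed

section \<open>Digits, fractional parts and the step of the algorithm\<close>

lemma \<alpha>\<^sub>0_eq: "i < n \<Longrightarrow> \<alpha>\<^sub>0 i = of_int (d i) + S 0 i"
  using \<omega>_pos by (simp add: \<alpha>\<^sub>0_def S_0 lessThan_Suc_atMost[symmetric] add_divide_distrib)

lemma \<alpha>\<^sub>0_S_Suc: "i < n \<Longrightarrow> \<alpha>\<^sub>0 i = \<omega> * S 0 (Suc i)"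
  using \<omega>_pos by (simp add: \<alpha>\<^sub>0_def S_0 lessThan_Suc_atMost)

lemma \<alpha>\<^sub>0_last: "\<alpha>\<^sub>0 (n - 1) = \<omega>"
  using \<alpha>\<^sub>0_S_Suc[of "n - 1"] S_full[of 0] n by (simp add: y_0)

lemma floor_\<alpha>\<^sub>0: "1 \<le> i \<Longrightarrow> i < n \<Longrightarrow> \<lfloor>\<alpha>\<^sub>0 i\<rfloor> = d i"
  using S_pos[of i 0] S_less_y[of i 0] m by (simp add: \<alpha>\<^sub>0_eq y_0 floor_unique)

lemma floor_quot:
  assumes "1 \<le> i" "i < n"
  shows "\<lfloor>quot r i\<rfloor> = (if r = 0 \<or> m < r + i then d i else c i)"
  using assms floor_\<alpha>\<^sub>0[of i] S_pos[of i r] S_less_y[of i r] y_pos[of r]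
  by (auto simp: quot_def intro!: floor_unique)

lemma frac_quot:
  assumes "1 \<le> i" "i < n"
  shows "quot r i - of_int \<lfloor>quot r i\<rfloor> = (if m < r + i then S 0 i else S r i / y r)"
  unfolding floor_quot[OF assms] using assms m by (auto simp: quot_def \<alpha>\<^sub>0_eq y_0)

lemma frac_quot_1:
  assumes "r < m"
  shows "quot r 1 - of_int \<lfloor>quot r 1\<rfloor> = y (Suc r) / y r"
  using frac_quot[of 1 r] n assms c0 by (simp add: S_def)

text \<open>Early on, this is \<open>S r n = y r\<close> with its last summand peeled off; in the
  geometric range both sides are \<open>\<omega>\<close>.\<close>

lemma quot_Suc_last:
  assumes "r < m"
  shows "quot (Suc r) (n - 1) = y r / y (Suc r)"
proof (cases "r \<le> m - n")
  case True
  have "S r n = of_int (c (n - 1)) * y (Suc r) + S (Suc r) (n - 1)"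
    using S_peel[of r "n - 1"] n by simp
  with True have "y r = of_int (c (n - 1)) * y (Suc r) + S (Suc r) (n - 1)"
    by (simp add: S_full)
  moreover have "\<not> m < Suc r + (n - 1)" using True m n by linarith
  ultimately show ?thesis
    using y_pos[of "Suc r"] by (simp add: quot_def add_divide_distrib)
next
  case False
  then have "m < Suc r + (n - 1)" using m n by linarith
  then have "quot (Suc r) (n - 1) = \<omega>" unfolding quot_def \<alpha>\<^sub>0_last by simp
  then show ?thesis
    using False assms y_Suc_geometric[of r] y_pos[of r] \<omega>_pos by simp
qed

text \<open>Without wrap-around the step peels one summand off \<open>S r (Suc i)\<close>. After it,
  the step multiplies by \<open>\<omega>\<close> and turns \<open>S 0 (Suc i)\<close> into an entry
  of the initial vector.\<close>

lemma jpa_step_quot: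
  assumes "r < m" "i \<in> {1..n-1}"
  shows "jpa_step n (quot r) i = quot (Suc r) i"
proof (cases "i < n - 1")
  case False
  with assms have "i = n - 1" by simp
  then show ?thesis
    using assms quot_Suc_last[of r] frac_quot_1[of r] y_pos by (simp add: jpa_step_def)
next
  case True
  then have step: "jpa_step n (quot r) i
      = (if m < r + Suc i then S 0 (Suc i) else S r (Suc i) / y r) * (y r / y (Suc r))"
    using frac_quot[of "Suc i" r] frac_quot_1[OF assms(1)] by (simp add: jpa_step_def)
  show ?thesis
  proof (cases "m < r + Suc i")
    case wrap: True
    have "y (Suc r) = y r / \<omega>" using wrap True assms m by (intro y_Suc_geometric) linarith+
    then have "y r / y (Suc r) = \<omega>" using y_pos[of r] \<omega>_pos by simp
    then show ?thesis
      using wrap True step \<alpha>\<^sub>0_S_Suc[of i] by (simp add: quot_def mult.commute)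
  next
    case no_wrap: False
    then have "jpa_step n (quot r) i = S r (Suc i) / y (Suc r)"
      using step y_pos[of r] by simp
    then show ?thesis
      using no_wrap y_pos[of "Suc r"] by (simp add: quot_def S_peel add_divide_distrib)
  qed
qed

lemma quot_period: "1 \<le> i \<Longrightarrow> quot m i = quot 0 i"
  by (simp add: quot_def)

lemma jpa_eq_quot:
  assumes "\<And>i. i \<in> {1..n-1} \<Longrightarrow> \<alpha> i = \<alpha>\<^sub>0 i" "i \<in> {1..n-1}"
  shows "jpa n \<alpha> \<nu> i = quot (\<nu> mod m) i"
  using assms(2)
proof (induction \<nu> arbitrary: i)
  case 0
  then show ?case using assms(1) by (simp add: jpa_def quot_def)
next
  case (Suc \<nu>)
  have "jpa n \<alpha> (Suc \<nu>) i = jpa_step n (quot (\<nu> mod m)) i"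
    unfolding jpa_Suc using n Suc.IH by (rule jpa_step_cong)
  also have "\<dots> = quot (Suc (\<nu> mod m)) i"
    using Suc.prems n m by (intro jpa_step_quot) auto
  also have "\<dots> = quot (Suc \<nu> mod m) i"
    using quot_period[of i] Suc.prems by (auto simp: mod_Suc)
  finally show ?case .
qed

section \<open>The unit and the minimality of the period\<close>

lemma \<omega>_poly_times_y:
  "(\<Sum>i<n. of_int (u i m) * \<omega> ^ i) * y m = 1"
proof -
  define V where "V k = (\<Sum>i<n. of_int (u i k) * \<omega> ^ i)" for k
  define \<chi> where "\<chi> = \<omega> ^ n - (\<Sum>i<n. of_int (c i) * \<omega> ^ i)"
  \<comment> \<open>This is f = \<chi> - t \<epsilon> evaluated at the root
    \<open>\<omega>\<close>.\<close>
  have \<chi>: "\<chi> = of_int t * V m"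
    unfolding \<chi>_def \<omega>_root V_def by (simp add: algebra_simps sum.distrib sum_distrib_left)
  have V_Suc: "V (Suc k) = \<omega> * V k - of_int (u (n - 1) k) * \<chi>" for k
    unfolding V_def \<chi>_def using n by (intro recurrence_seq_poly_Suc) auto
  have V_0: "V 0 = 1"
  proof -
    have "V 0 = (\<Sum>i<n. if i = 0 then 1 else 0)"
      unfolding V_def using n by (intro sum.cong) (auto simp: recurrence_seq_initial)
    then show ?thesis using n by simp
  qed
  have V: "V k = \<omega> ^ k - \<chi> * (\<Sum>p<k. of_int (u (n - 1) (k - 1 - p)) * \<omega> ^ p)" for k
  proof (induction k)
    case (Suc k)
    have "(\<Sum>p<Suc k. of_int (u (n - 1) (Suc k - 1 - p)) * \<omega> ^ p)
        = of_int (u (n - 1) k) + \<omega> * (\<Sum>p<k. of_int (u (n - 1) (k - 1 - p)) * \<omega> ^ p)"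
      unfolding sum.lessThan_Suc_shift by (simp add: sum_distrib_left mult_ac)
    then show ?case unfolding V_Suc Suc by (simp add: algebra_simps)
  qed (simp add: V_0)
  have "V m * (1 + of_int t * (\<Sum>p<m. of_int (q p) * \<omega> ^ p)) = \<omega> ^ m"
    using V[of m] by (simp add: \<chi> q_def algebra_simps)
  then have "V m * y m = 1" using \<omega>_pos by (simp add: y_def)
  then show ?thesis by (simp add: V_def)
qed

lemma prod_quot_last:
  "(\<Prod>\<nu><m. quot \<nu> (n - 1)) = (\<Sum>i<n. of_int (u i m) * \<omega> ^ i)"
proof -
  have partial: "(\<Prod>\<nu><k. quot (Suc \<nu>) (n - 1)) = 1 / y k" if "k \<le> m" for k
    using that
  proof (induction k)
    case (Suc k)
    then show ?case using quot_Suc_last[of k] y_pos[of k] by simp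
  qed (simp add: y_0)
  obtain m' where m': "m = Suc m'" using m n by (cases m) auto
  \<comment> \<open>Periodicity trades the factor at 0 for the one at \<open>m\<close>, so that the
    indices 1 to \<open>m\<close> telescope.\<close>
  have "(\<Prod>\<nu><m. quot \<nu> (n - 1)) = quot 0 (n - 1) * (\<Prod>\<nu><m'. quot (Suc \<nu>) (n - 1))"
    unfolding m' by (rule prod.lessThan_Suc_shift)
  also have "\<dots> = (\<Prod>\<nu><m. quot (Suc \<nu>) (n - 1))"
    using quot_period[of "n - 1"] n m' by simp
  also have "\<dots> = 1 / y m" by (rule partial) simp
  also have "\<dots> = (\<Sum>i<n. of_int (u i m) * \<omega> ^ i)"
    using \<omega>_poly_times_y y_pos[of m] by (simp add: field_simps)
  finally show ?thesis .
qed

text \<open>In the cyclic word of the last digits over one period, \<open>d (n - 1)\<close> is followed by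
  \<open>c (n - 1)\<close> only at the start of the period.\<close>

lemma no_shorter_period:
  assumes l: "0 < l" "l < m" and eq: "\<And>\<nu>. quot ((\<nu> + l) mod m) (n - 1) = quot (\<nu> mod m) (n - 1)"
  shows False
proof -
  have last: "\<lfloor>quot r (n - 1)\<rfloor> = (if r = 0 \<or> m < r + (n - 1) then d (n - 1) else c (n - 1))" for r
    using n by (intro floor_quot) auto
  have "\<lfloor>quot l (n - 1)\<rfloor> = d (n - 1)"
    using eq[of 0] l last[of 0] by simp
  then have "m < l + (n - 1)"
    using last[of l] l c_last_less_d_last by (auto split: if_splits)
  \<comment> \<open>The successor of \<open>l\<close> stays in the final run of large digits, or is
    0 when \<open>l = m - 1\<close>.\<close>
  then have "\<lfloor>quot (Suc l mod m) (n - 1)\<rfloor> = d (n - 1)"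
    unfolding last using l by (auto simp: mod_Suc)
  moreover have "\<lfloor>quot (Suc l mod m) (n - 1)\<rfloor> = c (n - 1)"
    using eq[of 1] last[of 1] n m by simp
  ultimately show False using c_last_less_d_last by simp
qed

section \<open>Transfer to any vector with the prescribed entries 1 to n - 1\<close>

context
  fixes \<alpha> :: "nat \<Rightarrow> real"
  assumes \<alpha>: "\<And>i. i \<in> {1..n-1} \<Longrightarrow> \<alpha> i = \<alpha>\<^sub>0 i"
begin

lemma jpa_well_defined_\<alpha>: "jpa_well_defined n \<alpha>"
  unfolding jpa_well_defined_def jpa_digit_def
proof
  fix \<nu>
  have "\<nu> mod m < m" using n m by simp
  then have "quot (\<nu> mod m) 1 - of_int \<lfloor>quot (\<nu> mod m) 1\<rfloor> \<noteq> 0"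
    unfolding frac_quot_1[OF \<open>\<nu> mod m < m\<close>]
    using y_pos[of "\<nu> mod m"] y_pos[of "Suc (\<nu> mod m)"] by simp
  then show "jpa n \<alpha> \<nu> 1 \<noteq> of_int \<lfloor>jpa n \<alpha> \<nu> 1\<rfloor>"
    using jpa_eq_quot[OF \<alpha>, of 1 \<nu>] n by simp
qed

lemma jpa_has_period_\<alpha>: "jpa_has_period n \<alpha> 0 m"
  using n m jpa_eq_quot[OF \<alpha>] by (auto simp: jpa_has_period_def)

lemma jpa_preperiod_length_\<alpha>: "jpa_preperiod_length n \<alpha> = 0"
  unfolding jpa_preperiod_length_def using jpa_has_period_\<alpha> by (intro Least_eq_0) blast

lemma jpa_purely_periodic_\<alpha>: "jpa_purely_periodic n \<alpha>"
  using jpa_has_period_\<alpha> jpa_preperiod_length_\<alpha>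
  by (auto simp: jpa_purely_periodic_def jpa_periodic_def)

lemma jpa_period_length_\<alpha>: "jpa_period_length n \<alpha> = m"
  unfolding jpa_period_length_def jpa_preperiod_length_\<alpha>
proof (rule Least_equality)
  show "jpa_has_period n \<alpha> 0 m" by (rule jpa_has_period_\<alpha>)
next
  fix l assume l: "jpa_has_period n \<alpha> 0 l"
  have "quot ((\<nu> + l) mod m) (n - 1) = quot (\<nu> mod m) (n - 1)" for \<nu>
    using l n jpa_eq_quot[OF \<alpha>, of "n - 1" \<nu>] jpa_eq_quot[OF \<alpha>, of "n - 1" "\<nu> + l"]
    by (simp add: jpa_has_period_def)
  then show "m \<le> l"
    using no_shorter_period[of l] l by (force simp: jpa_has_period_def)
qed

lemma jpa_digit_\<alpha>:
  assumes "i \<in> {1..n-1}"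
  shows "jpa_digit n \<alpha> \<nu> i = (if \<nu> mod m = 0 \<or> m < \<nu> mod m + i then d i else c i)"
  using assms floor_quot[of i "\<nu> mod m"] jpa_eq_quot[OF \<alpha>, of i \<nu>] by (auto simp: jpa_digit_def)

lemma hasse_bernstein_unit_\<alpha>:
  "hasse_bernstein_unit n \<alpha> = (\<Prod>\<nu><m. jpa n \<alpha> \<nu> (n - 1))"
  by (simp add: hasse_bernstein_unit_def jpa_preperiod_length_\<alpha> jpa_period_length_\<alpha>
      atLeast0LessThan)

lemma hasse_bernstein_unit_\<alpha>_eq:
  "hasse_bernstein_unit n \<alpha> = (\<Sum>i<n. of_int (u i m) * \<omega> ^ i)"
proof -
  have "(\<Prod>\<nu><m. jpa n \<alpha> \<nu> (n - 1)) = (\<Prod>\<nu><m. quot \<nu> (n - 1))"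
    using n jpa_eq_quot[OF \<alpha>, of "n - 1"] by (intro prod.cong) auto
  then show ?thesis unfolding hasse_bernstein_unit_\<alpha> prod_quot_last .
qed

end

end

theorem theorem1:
  fixes n m :: nat and t :: int and c :: "nat \<Rightarrow> int" and u :: "nat \<Rightarrow> nat \<Rightarrow> int"
    and f :: "real poly" and \<omega> :: real and \<alpha> :: "nat \<Rightarrow> real"
  assumes "n \<ge> 2" and "m \<ge> n" and "t \<ge> 1"
    and "c 0 = 1"
    and "\<And>i. 1 \<le> i \<Longrightarrow> i + 1 \<le> n - 1 \<Longrightarrow> c i \<le> c (i + 1)"
    and "c 1 \<ge> 0"
    and "c (n - 1) \<ge> c 0"
    and "u = recurrence_seq n c"
    and "f = monom 1 n - (\<Sum>i<n. monom (of_int (u i m * t + c i)) i)"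
    and "\<omega> = (THE x. x > 0 \<and> poly f x = 0)"
    and "\<And>i. i \<in> {1..n-1} \<Longrightarrow>
           \<alpha> i = (\<Sum>j=0..i. of_int (u j m * t + c j) * \<omega> powi (int j - int i))"
  shows "(\<exists>!x. x > 0 \<and> poly f x = 0)
    \<and> jpa_well_defined n \<alpha>
    \<and> jpa_purely_periodic n \<alpha>
    \<and> jpa_period_length n \<alpha> = m
    \<and> (\<forall>\<nu> r. r = \<nu> mod m \<longrightarrow>
         (r = 0 \<longrightarrow> (\<forall>i\<in>{1..n-1}. jpa_digit n \<alpha> \<nu> i = u i m * t + c i))
       \<and> (1 \<le> r \<and> r \<le> m - n + 1 \<longrightarrow> (\<forall>i\<in>{1..n-1}. jpa_digit n \<alpha> \<nu> i = c i))
       \<and> (m - n + 2 \<le> r \<and> r \<le> m - 1 \<longrightarrow>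
            (\<forall>i\<in>{1..m-r}. jpa_digit n \<alpha> \<nu> i = c i)
          \<and> (\<forall>i\<in>{m-r+1..n-1}. jpa_digit n \<alpha> \<nu> i = u i m * t + c i)))
    \<and> hasse_bernstein_unit n \<alpha> = (\<Prod>\<nu>=0..m-1. jpa n \<alpha> \<nu> (n - 1))
    \<and> hasse_bernstein_unit n \<alpha> = (\<Sum>i<n. of_int (u i m) * \<omega> ^ i)"
proof -
  have c_mono: "c i \<le> c j" if "1 \<le> i" "i \<le> j" "j < n" for i j
    using that(2,3)
  proof (induction j rule: dec_induct)
    case (step k)
    then show ?case using assms(5)[of k] that(1) by force
  qed simp
  \<comment> \<open>Monotonicity starts at index 1, so index 0 is covered by
    \<open>c 0 = 1\<close>.\<close>
  have c_nonneg: "0 \<le> c j" if "j < n" for j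
    using that c_mono[of 1 j] assms(4,6) by (cases j) auto
  have u_nonneg: "0 \<le> u i k" for i k
    unfolding assms(8) using c_nonneg by (rule recurrence_seq_nonneg)
  have root: "\<exists>!x. x > 0 \<and> poly f x = 0"
    unfolding assms(9)
  proof (rule unique_positive_root)
    show "0 < real_of_int (u 0 m * t + c 0)"
      using u_nonneg[of 0 m] assms(3,4) by (simp add: add_nonneg_pos)
    show "0 \<le> real_of_int (u i m * t + c i)" if "i < n" for i
      using u_nonneg[of i m] c_nonneg[OF that] assms(3) by simp
  qed (use assms(1) in auto)
  from theI'[OF root] have \<omega>: "0 < \<omega>" "poly f \<omega> = 0" by (auto simp: assms(10))
  interpret P: perturbed_recurrence n m t c \<omega>
  proof
    show "\<omega> ^ n = (\<Sum>i<n. of_int (recurrence_seq n c i m * t + c i) * \<omega> ^ i)"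
      using \<omega>(2) by (simp add: assms(8,9) poly_sum poly_monom)
  qed (use assms(1-4,7) \<omega>(1) c_mono c_nonneg in auto)
  have d: "P.d i = u i m * t + c i" for i
    by (simp add: P.d_def assms(8))
  have \<alpha>: "\<alpha> i = P.\<alpha>\<^sub>0 i" if "i \<in> {1..n-1}" for i
    unfolding assms(11)[OF that] P.\<alpha>\<^sub>0_def d sum_divide_distrib atLeast0AtMost
    using \<omega>(1) by (intro sum.cong) (auto simp: power_int_diff)
  have digit: "jpa_digit n \<alpha> \<nu> i
      = (if \<nu> mod m = 0 \<or> m < \<nu> mod m + i then u i m * t + c i else c i)"
    if "i \<in> {1..n-1}" for \<nu> i
    using P.jpa_digit_\<alpha>[OF \<alpha> that] by (simp add: d)
  have "{..<m} = {0..m-1}" using assms(1,2) by auto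
  then have "hasse_bernstein_unit n \<alpha> = (\<Prod>\<nu>=0..m-1. jpa n \<alpha> \<nu> (n - 1))"
    using P.hasse_bernstein_unit_\<alpha>[OF \<alpha>] by simp
  moreover have "hasse_bernstein_unit n \<alpha> = (\<Sum>i<n. of_int (u i m) * \<omega> ^ i)"
    using P.hasse_bernstein_unit_\<alpha>_eq[OF \<alpha>] by (simp add: assms(8))
  moreover have "(r = 0 \<longrightarrow> (\<forall>i\<in>{1..n-1}. jpa_digit n \<alpha> \<nu> i = u i m * t + c i))
       \<and> (1 \<le> r \<and> r \<le> m - n + 1 \<longrightarrow> (\<forall>i\<in>{1..n-1}. jpa_digit n \<alpha> \<nu> i = c i))
       \<and> (m - n + 2 \<le> r \<and> r \<le> m - 1 \<longrightarrow>
            (\<forall>i\<in>{1..m-r}. jpa_digit n \<alpha> \<nu> i = c i)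
          \<and> (\<forall>i\<in>{m-r+1..n-1}. jpa_digit n \<alpha> \<nu> i = u i m * t + c i))"
    if r: "r = \<nu> mod m" for \<nu> r
  proof (intro conjI impI ballI)
    fix i assume "r = 0" "i \<in> {1..n-1}"
    then show "jpa_digit n \<alpha> \<nu> i = u i m * t + c i" using digit[of i \<nu>] r by simp
  next
    fix i assume *: "1 \<le> r \<and> r \<le> m - n + 1" "i \<in> {1..n-1}"
    then have "\<not> (r = 0 \<or> m < r + i)" using assms(1,2) by auto
    then show "jpa_digit n \<alpha> \<nu> i = c i" using digit[OF *(2), of \<nu>] r by simp
  next
    fix i assume *: "m - n + 2 \<le> r \<and> r \<le> m - 1" "i \<in> {1..m-r}"
    \<comment> \<open>In this range \<open>m - r \<le> n - 2\<close>, so \<open>i\<close> is a valid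
      index.\<close>
    then have "\<not> (r = 0 \<or> m < r + i)" "i \<in> {1..n-1}" using assms(1,2) by auto
    then show "jpa_digit n \<alpha> \<nu> i = c i" using digit[of i \<nu>] r by simp
  next
    fix i assume *: "m - n + 2 \<le> r \<and> r \<le> m - 1" "i \<in> {m-r+1..n-1}"
    then have "m < r + i" "i \<in> {1..n-1}" using assms(1,2) by auto
    then show "jpa_digit n \<alpha> \<nu> i = u i m * t + c i" using digit[of i \<nu>] r by simp
  qed
  ultimately show ?thesis
    using root P.jpa_well_defined_\<alpha>[OF \<alpha>] P.jpa_purely_periodic_\<alpha>[OF \<alpha>]
      P.jpa_period_length_\<alpha>[OF \<alpha>] by blast
qed

end
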